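(* Let $(F_n)_{n\ge 1}$ be the Fibonacci sequence and let $\mathcal{F} = 0.F_1F_2F_3\cdots = 0.11235813\cdots$ be the real number whose decimal expansion is obtained by concatenating, after the decimal point, the base-$10$ representations of $F_1, F_2, F_3, \ldots$ in order. Suppose that for every real $\varepsilon > 0$ and every $k \in \mathbb{N}$ (with $k\geq 1$), $$\#\{n \leq m : F_n \text{ is not } (\varepsilon,k)\text{-normal in base } 10\} = o(m) \quad \text{as } m \to \infty,$$ where $n$ ranges over positive integers. Then $\mathcal{F}$ is normal in base $10$.
   Context: The Fibonacci sequence is defined by $F_1 = 1$, $F_2 = 1$, and $F_n = F_{n-1} + F_{n-2}$ for $n \geq 3$. For an integer base $b \ge 2$ and a natural number $n\ge 1$, $\sigma_b(n)$ denotes the base-$b$ representation of $n$ (a finite digit string, most significant digit first, without leading zeros), and $|\sigma_b(n)|$ denotes its length (number of digits). For finite digit strings $w$ and $s$, $N(w,s)$ denotes the number of sliding-block (possibly overlapping) occurrences of $w$ as a contiguous block in $s$. A natural number $n$ is $(\varepsilon,k)$-normal in base $b$ if $$\left|\frac{N(w,\sigma_b(n))}{|\sigma_b(n)|} - b^{-k}\right| \leq \varepsilon$$ for every string $w \in \{0,1,\dots,b-1\}^k$. An irrational real number $\alpha$ is normal in the integer base $b \geq 2$ if, for every $k \in \mathbb{N}$ (with $k \ge 1$), every finite string $s \in \{0,1,\dots,b-1\}^k$ occurs in the base-$b$ expansion of (the fractional part of) $\alpha$ with asymptotic frequency $b^{-k}$; that is, the number of (possibly overlapping) occurrences of $s$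 within the first $M$ digits, divided by $M$, tends to $b^{-k}$ as $M \to \infty$. *)

theory Defs
  imports Complex_Main "HOL-Number_Theory.Fib" "HOL-Library.Landau_Symbols"
begin

text \<open>Base-\<open>b\<close> representation, most significant digit first; no leading zeros, so \<open>0\<close> is
  mapped to the empty string. The guard on \<open>b\<close> is only there for termination.\<close>

fun base_repr :: "nat \<Rightarrow> nat \<Rightarrow> nat list" where
  "base_repr b n = (if b < 2 \<or> n = 0 then [] else base_repr b (n div b) @ [n mod b])"

declare base_repr.simps [simp del]

definition occurrences :: "'a list \<Rightarrow> 'a list \<Rightarrow> nat" where
  "occurrences w s = card {i. i + length w \<le> length s \<and> take (length w) (drop i s) = w}"

definition base_strings :: "nat \<Rightarrow> nat \<Rightarrow> nat list set" where
  "base_strings b k = {w. length w = k \<and> set w \<subseteq> {..<b}}"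

definition nat_normal :: "real \<Rightarrow> nat \<Rightarrow> nat \<Rightarrow> nat \<Rightarrow> bool" where
  "nat_normal \<epsilon> k b n \<longleftrightarrow>
    (\<forall>w \<in> base_strings b k.
      \<bar>real (occurrences w (base_repr b n)) / real (length (base_repr b n)) - 1 / real b ^ k\<bar> \<le> \<epsilon>)"

text \<open>\<open>frac_digit b \<alpha> j\<close> is the digit of weight \<open>1 / b ^ Suc j\<close>: digit positions after the point
  are counted from \<open>0\<close>.\<close>

definition frac_digit :: "nat \<Rightarrow> real \<Rightarrow> nat \<Rightarrow> nat" where
  "frac_digit b \<alpha> j = nat (\<lfloor>real b ^ Suc j * frac \<alpha>\<rfloor> mod int b)"

definition real_normal :: "nat \<Rightarrow> real \<Rightarrow> bool" where
  "real_normal b \<alpha> \<longleftrightarrow> \<alpha> \<notin> \<rat> \<and>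
    (\<forall>k \<ge> 1. \<forall>w \<in> base_strings b k.
      (\<lambda>M. real (occurrences w (map (frac_digit b \<alpha>) [0..<M])) / real M)
        \<longlonglongrightarrow> 1 / real b ^ k)"

text \<open>Digit \<open>j\<close> (counted from \<open>0\<close>) of the infinite concatenation of the representations of
  \<open>a 1, a 2, \<dots>\<close>. For positive \<open>a n\<close> every block is nonempty, so the first \<open>j + 1\<close> blocks
  already contain that digit.\<close>

definition concat_digit :: "nat \<Rightarrow> (nat \<Rightarrow> nat) \<Rightarrow> nat \<Rightarrow> nat" where
  "concat_digit b a j = concat (map (\<lambda>n. base_repr b (a n)) [1..<j + 2]) ! j"

definition concat_real :: "nat \<Rightarrow> (nat \<Rightarrow> nat) \<Rightarrow> real" where
  "concat_real b a = (\<Sum>j. real (concat_digit b a j) / real b ^ Suc j)"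

lemma "map (concat_digit 10 fib) [0..<12] = [1, 1, 2, 3, 5, 8, 1, 3, 2, 1, 3, 4]"
  by code_simp

end

theory Submission
  imports Defs
begin

text \<open>
  The block \<open>F\<^sub>n\<close> has between \<open>n / 6\<close> and \<open>n\<close> digits, so the first \<open>m\<close> blocks together have
  length of order \<open>m\<^sup>2\<close>. Abnormal blocks among them number \<open>o(m)\<close> and contribute only \<open>o(m\<^sup>2)\<close>
  digits, while occurrences across block boundaries and the truncated last block contribute
  \<open>O(m)\<close>. Hence the concatenated digit sequence has the right block frequencies. Consequently it
  is not eventually \<open>9\<close>, so it is the digit expansion of its sum, and it contains arbitrarily
  long runs of zeros ended by a one, so the sum is irrational.
\<close>

section \<open>Occurrences of words\<close>

lemma finite_occurrences [simp]:
  "finite {i. i + length w \<le> length s \<and> take (length w) (drop i s) = w}"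
  by (rule finite_subset[of _ "{..length s}"]) auto

lemma occurrences_le_length:
  assumes "w \<noteq> []"
  shows "occurrences w s \<le> length s"
proof -
  have "{i. i + length w \<le> length s \<and> take (length w) (drop i s) = w} \<subseteq> {..<length s}"
    using assms by (auto simp: Suc_le_eq neq_Nil_conv)
  from card_mono[OF _ this] show ?thesis
    by (simp add: occurrences_def)
qed

text \<open>Sort occurrences in \<open>u @ v\<close> by starting position: inside \<open>u\<close>
  (\<open>?A\<close>), inside \<open>v\<close> (\<open>?B\<close>, shifted), or straddling the
  junction (\<open>?C\<close>). A straddling one starts among the last \<open>length w\<close>
  positions of \<open>u\<close>.\<close>

lemma occurrences_append_bounds:
  assumes "w \<noteq> []"
  shows "occurrences w u + occurrences w v \<le> occurrences w (u @ v)"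
    and "occurrences w (u @ v) \<le> occurrences w u + occurrences w v + length w"
proof -
  let ?P = "\<lambda>s. {i. i + length w \<le> length s \<and> take (length w) (drop i s) = w}"
  let ?A = "?P u" and ?B = "(+) (length u) ` ?P v"
  let ?C = "{i. length u < i + length w \<and> i < length u}"
  have card_B: "card ?B = occurrences w v"
    by (simp add: card_image occurrences_def)
  have union: "card (?A \<union> ?B) \<le> card (?P (u @ v))"
    by (rule card_mono[OF finite_occurrences]) auto
  show "occurrences w u + occurrences w v \<le> occurrences w (u @ v)"
  proof -
    have "?A \<inter> ?B = {}"
      using assms by auto
    then have "card (?A \<union> ?B) = card ?A + card ?B"
      by (intro card_Un_disjoint) auto
    with union card_B show ?thesis
      by (simp add: occurrences_def)
  qed
  have "?P (u @ v) \<subseteq> ?A \<union> ?B \<union> ?C"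
  proof
    fix i assume i: "i \<in> ?P (u @ v)"
    consider "i + length w \<le> length u" | "length u \<le> i" | "i \<in> ?C"
      by fastforce
    then show "i \<in> ?A \<union> ?B \<union> ?C"
    proof cases
      case 2
      with i have "i = length u + (i - length u)" "i - length u \<in> ?P v"
        by auto
      then show ?thesis by blast
    qed (use i in auto)
  qed
  moreover have "finite ?C" "card ?C \<le> length w"
  proof -
    have sub: "?C \<subseteq> {length u - length w..<length u}"
      by auto
    then show "finite ?C" by (rule finite_subset) simp
    from card_mono[OF _ sub] show "card ?C \<le> length w" by simp
  qed
  ultimately have "card (?P (u @ v)) \<le> card (?A \<union> ?B \<union> ?C)"
    by (intro card_mono) auto
  also have "\<dots> \<le> card ?A + card ?B + card ?C"
    by (meson add_mono card_Un_le le_refl order_trans)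
  finally show "occurrences w (u @ v) \<le> occurrences w u + occurrences w v + length w"
    using \<open>card ?C \<le> length w\<close> card_B by (simp add: occurrences_def)
qed

text \<open>Left undivided by the length, so that errors of consecutive pieces simply add
  up.\<close>

definition discrepancy :: "real \<Rightarrow> 'a list \<Rightarrow> 'a list \<Rightarrow> real" where
  "discrepancy p w s = \<bar>real (occurrences w s) - p * real (length s)\<bar>"

lemma discrepancy_append:
  assumes "w \<noteq> []"
  shows "discrepancy p w (u @ v) \<le> discrepancy p w u + discrepancy p w v + real (length w)"
  using occurrences_append_bounds[OF assms, of u v]
  unfolding discrepancy_def by (simp add: ring_distribs)

lemma discrepancy_le_length:
  assumes "w \<noteq> []" "0 \<le> p" "p \<le> 1"
  shows "discrepancy p w s \<le> real (length s)"
proof -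
  have "real (occurrences w s) \<le> real (length s)"
    using occurrences_le_length[OF assms(1), of s] by simp
  moreover have "0 \<le> p * real (length s)" "p * real (length s) \<le> real (length s)"
    using assms by (auto intro: mult_left_le_one_le)
  ultimately show ?thesis
    unfolding discrepancy_def by linarith
qed

text \<open>Each block is charged \<open>length w\<close> once, for the junction that follows it;
  the charge for the last block is slack.\<close>

lemma discrepancy_concat:
  assumes "w \<noteq> []"
  shows "discrepancy p w (concat ss) \<le> (\<Sum>s\<leftarrow>ss. discrepancy p w s + real (length w))"
proof (induction ss)
  case Nil
  then show ?case
    using occurrences_le_length[OF assms, of "[]"] by (simp add: discrepancy_def)
next
  case (Cons s ss)
  then show ?case
    using discrepancy_append[OF assms, of p s "concat ss"] by simp
qed

text \<open>If every occurrence started before \<open>J\<close>, the counts would stay at most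
  \<open>J\<close> and the frequency would tend to 0.\<close>

lemma occurs_beyond:
  fixes d :: "nat \<Rightarrow> 'a"
  assumes lim: "(\<lambda>M. real (occurrences w (map d [0..<M])) / real M) \<longlonglongrightarrow> c"
    and "c \<noteq> 0"
  shows "\<exists>i\<ge>J. map d [i..<i + length w] = w"
proof (rule ccontr)
  assume none: "\<not> ?thesis"
  have bound: "occurrences w (map d [0..<M]) \<le> J" for M
  proof -
    have "{i. i + length w \<le> length (map d [0..<M]) \<and>
        take (length w) (drop i (map d [0..<M])) = w} \<subseteq> {..<J}"
      using none by (force simp: drop_map take_map not_le[symmetric])
    from card_mono[OF _ this] show ?thesis
      by (simp add: occurrences_def)
  qed
  have "(\<lambda>M. real (occurrences w (map d [0..<M])) / real M) \<longlonglongrightarrow> 0"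
  proof (rule tendsto_sandwich[OF _ _ tendsto_const])
    show "(\<lambda>M. real J / real M) \<longlonglongrightarrow> 0"
      by (rule lim_const_over_n)
  qed (use bound in \<open>auto intro!: always_eventually divide_right_mono\<close>)
  with lim \<open>c \<noteq> 0\<close> show False
    using LIMSEQ_unique by blast
qed

section \<open>Real numbers with normal digit sequences\<close>

text \<open>Once all tails of the series are known to lie in [0,1), multiplying by powers of
  \<open>b\<close> and taking floors recovers \<open>d\<close>, so the assumed frequencies are those
  of the real number itself.\<close>

lemma real_normal_digit_series:
  fixes d :: "nat \<Rightarrow> nat"
  assumes b: "b \<ge> 2" and d: "\<And>j. d j < b"
    and lim: "\<And>k w. k \<ge> 1 \<Longrightarrow> w \<in> base_strings b k \<Longrightarrow>
      (\<lambda>M. real (occurrences w (map d [0..<M])) / real M) \<longlonglongrightarrow> 1 / real b ^ k"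
  shows "real_normal b (\<Sum>j. real (d j) / real b ^ Suc j)"
proof -
  \<comment> \<open>The tail \<open>r j\<close> is the value of the expansion that starts at digit
    \<open>j\<close>.\<close>
  define r where "r j = (\<Sum>i. real (d (i + j)) / real b ^ Suc i)" for j
  have geom: "(\<lambda>i. real (b - 1) / real b ^ Suc i) sums 1"
  proof -
    have "(\<lambda>i. real (b - 1) / real b * (1 / real b) ^ i) sums
        (real (b - 1) / real b * (1 / (1 - 1 / real b)))"
      by (intro sums_mult geometric_sums) (use b in auto)
    then show ?thesis
      using b by (simp add: field_simps of_nat_diff)
  qed
  have le: "real (d (i + j)) / real b ^ Suc i \<le> real (b - 1) / real b ^ Suc i" for i j
    using d[of "i + j"] by (intro divide_right_mono) auto
  have summable: "summable (\<lambda>i. real (d (i + j)) / real b ^ Suc i)" for j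
    by (rule summable_comparison_test'[OF sums_summable[OF geom], of 0])
      (use le[of _ j] in auto)
  have r_nonneg: "0 \<le> r j" for j
    unfolding r_def by (rule suminf_nonneg[OF summable]) simp
  have r_le_1: "r j \<le> 1" for j
    using suminf_le[OF le summable sums_summable[OF geom], of j] sums_unique[OF geom]
    by (simp add: r_def)
  have r_Suc: "real b * r j = real (d j) + r (Suc j)" for j
  proof -
    have "real b * r j = (\<Sum>i. real (d (i + j)) / real b ^ i)"
      unfolding r_def using b
      by (subst suminf_mult[OF summable, symmetric]) simp
    also have "\<dots> = real (d j) + r (Suc j)"
    proof -
      have "summable (\<lambda>i. real (d (i + j)) / real b ^ i)"
        using summable_mult[OF summable[of j], of "real b"] b by simp
      from suminf_split_head[OF this] show ?thesis
        by (simp add: r_def)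
    qed
    finally show ?thesis .
  qed
  have r_less_1: "r j < 1" for j
  proof (rule ccontr)
    assume "\<not> r j < 1"
    then have base: "r j = 1"
      using r_le_1[of j] by simp
    \<comment> \<open>In \<open>b * r i = d i + r (Suc i)\<close> the right side is at most
      \<open>(b - 1) + 1\<close>, so \<open>r i = 1\<close> forces equality in both
      summands.\<close>
    have step: "r (Suc i) = 1 \<and> d i = b - 1" if "r i = 1" for i
    proof -
      have "real (d i) + 1 \<le> real b"
        using d[of i] by linarith
      then have "r (Suc i) = 1" "real (d i) + 1 = real b"
        using r_Suc[of i] r_le_1[of "Suc i"] that by simp_all
      then show ?thesis
        by linarith
    qed
    have "r (j + n) = 1" for n
      by (induction n) (use base step in auto)
    then have nines: "d i = b - 1" if "i \<ge> j" for i
      using step that by (metis le_add_diff_inverse)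
    \<comment> \<open>The digit 0 has positive frequency and hence recurs beyond \<open>j\<close>;
      it differs from \<open>b - 1\<close> because \<open>b\<close> is at least 2.\<close>
    have "\<exists>i\<ge>j. map d [i..<i + length [0::nat]] = [0]"
      by (rule occurs_beyond[OF lim[of 1]]) (use b in \<open>auto simp: base_strings_def\<close>)
    then show False
      using nines b by auto
  qed
  \<comment> \<open>\<open>N\<close> is the integer written by the first \<open>j\<close>
    digits.\<close>
  have shift: "\<exists>N::int. real b ^ j * r 0 = of_int N + r j" for j
  proof (induction j)
    case 0
    show ?case by (rule exI[of _ 0]) simp
  next
    case (Suc j)
    then obtain N :: int where "real b ^ j * r 0 = of_int N + r j" ..
    then have "real b ^ Suc j * r 0 = of_int (int b * N + int (d j)) + r (Suc j)"
      using r_Suc[of j] by (simp add: algebra_simps)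
    then show ?case ..
  qed
  have digit: "frac_digit b (r 0) j = d j" for j
  proof -
    obtain N :: int where "real b ^ j * r 0 = of_int N + r j"
      using shift by blast
    then have "real b ^ Suc j * r 0 = of_int (int b * N + int (d j)) + r (Suc j)"
      using r_Suc[of j] by (simp add: algebra_simps)
    then have "\<lfloor>real b ^ Suc j * r 0\<rfloor> = int b * N + int (d j)"
      using r_nonneg[of "Suc j"] r_less_1[of "Suc j"] by linarith
    moreover have "frac (r 0) = r 0"
      using r_nonneg r_less_1 by (simp add: frac_eq)
    ultimately show ?thesis
      using d[of j] by (simp add: frac_digit_def)
  qed
  \<comment> \<open>A long run of zeros followed by a one makes some tail \<open>r i\<close> positive but smaller than
    the reciprocal of any prescribed denominator.\<close>
  have "r 0 \<notin> \<rat>"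
  proof
    assume "r 0 \<in> \<rat>"
    then obtain p q :: int where q: "q > 0" and pq: "r 0 = of_int p / of_int q"
      by (metis Rats_cases')
    \<comment> \<open>As many zeros as the denominator suffice, since
      \<open>q < b ^ q\<close>.\<close>
    define k where "k = nat q"
    define w where "w = replicate k (0::nat) @ [1]"
    have "\<exists>i\<ge>0. map d [i..<i + length w] = w"
      by (rule occurs_beyond[OF lim[of "Suc k"]])
        (use b in \<open>auto simp: base_strings_def w_def\<close>)
    then obtain i where i: "map d [i..<i + length w] = w"
      by blast
    have d_i: "d (i + t) = w ! t" if "t \<le> k" for t
      using arg_cong[OF i, of "\<lambda>u. u ! t"] that by (simp add: w_def nth_append split: if_splits)
    have run: "real b ^ t * r i = r (i + t)" if "t \<le> k" for t
      using that
    proof (induction t)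
      case (Suc t)
      then have "d (i + t) = 0"
        using d_i[of t] by (simp add: w_def nth_append)
      then show ?case
        using Suc r_Suc[of "i + t"] by (simp add: algebra_simps)
    qed simp
    \<comment> \<open>The final one of \<open>w\<close> keeps the tail \<open>r i\<close> from
      vanishing.\<close>
    have "d (i + k) = 1"
      using d_i[of k] by (simp add: w_def nth_append)
    then have "real b * r (i + k) > 0"
      using r_Suc[of "i + k"] r_nonneg[of "Suc (i + k)"] by simp
    then have "r (i + k) > 0"
      using r_nonneg[of "i + k"] by (simp add: zero_less_mult_iff)
    then have pos: "r i > 0"
      using run[of k] b by (metis le_refl of_nat_0_le_iff r_nonneg mult_zero_right less_eq_real_def)
    obtain N :: int where N: "real b ^ i * r 0 = of_int N + r i"
      using shift by blast
    \<comment> \<open>Every tail differs from a multiple of \<open>p / q\<close> by an integer, so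
      \<open>q\<close> clears its denominator. A positive tail is thus at least
      \<open>1 / q\<close>.\<close>
    have "of_int q * r i = of_int (int b ^ i * p - q * N)"
    proof -
      have "of_int q * r i = real b ^ i * (of_int q * r 0) - of_int q * of_int N"
        using N by (simp add: algebra_simps)
      then show ?thesis
        using q pq by simp
    qed
    moreover have "of_int q * r i > 0"
      using pos q by simp
    ultimately have ge: "of_int q * r i \<ge> 1"
      by (metis of_int_0_less_iff of_int_1_le_iff int_one_le_iff_zero_less)
    have "real k < real b ^ k"
    proof -
      have "k < b ^ k"
        using b by (intro less_exp[THEN order.strict_trans2] power_mono) auto
      then show ?thesis
        by (metis of_nat_less_iff of_nat_power)
    qed
    \<comment> \<open>The right side equals \<open>r (i + k)\<close>, which is below 1, whereas the
      left side is at least 1.\<close>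
    then have "of_int q * r i < real b ^ k * r i"
      using pos q by (simp add: k_def)
    with ge run[of k] r_less_1[of "i + k"] show False
      by simp
  qed
  moreover have "(\<Sum>j. real (d j) / real b ^ Suc j) = r 0"
    by (simp add: r_def)
  ultimately show ?thesis
    using lim digit by (simp add: real_normal_def cong: map_cong)
qed

section \<open>Concatenated representations\<close>

lemma base_repr_less:
  assumes "x \<in> set (base_repr b n)"
  shows "x < b"
  using assms
proof (induction b n rule: base_repr.induct)
  case (1 b n)
  then show ?case
    by (simp add: base_repr.simps[of b n] split: if_splits) auto
qed

text \<open>Dividing by \<open>b\<close> removes exactly one digit; this converts size bounds into
  digit counts.\<close>

lemma length_base_repr_le_iff:
  assumes "b \<ge> 2"
  shows "length (base_repr b n) \<le> k \<longleftrightarrow> n < b ^ k"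
proof (induction k arbitrary: n)
  case 0
  then show ?case
    using assms by (subst base_repr.simps) auto
next
  case (Suc k)
  show ?case
    using assms Suc[of "n div b"]
    by (subst base_repr.simps) (auto simp: less_mult_imp_div_less div_less_iff_less_mult mult.commute)
qed

text \<open>With the bound \<open>Suc m\<close> there are exactly \<open>m\<close> blocks, so
  \<open>concat_digit b a j\<close> reads position \<open>j\<close> of the prefix with
  \<open>Suc j\<close> blocks.\<close>

definition concat_prefix :: "nat \<Rightarrow> (nat \<Rightarrow> nat) \<Rightarrow> nat \<Rightarrow> nat list" where
  "concat_prefix b a m = concat (map (\<lambda>n. base_repr b (a n)) [1..<Suc m])"

lemma concat_prefix_Suc:
  "concat_prefix b a (Suc m) = concat_prefix b a m @ base_repr b (a (Suc m))"
  by (simp add: concat_prefix_def)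

lemma length_concat_prefix:
  "length (concat_prefix b a m) = (\<Sum>n=1..m. length (base_repr b (a n)))"
  by (induction m) (auto simp: concat_prefix_Suc, simp add: concat_prefix_def)

lemma concat_prefix_append:
  "\<exists>t. concat_prefix b a (m + n) = concat_prefix b a m @ t"
  by (induction n) (auto simp: concat_prefix_Suc)

text \<open>Positivity of the terms excludes empty blocks, as 0 is represented by the empty
  string.\<close>

locale concatenation =
  fixes b :: nat and a :: "nat \<Rightarrow> nat"
  assumes base: "b \<ge> 2" and pos: "\<And>n. n \<ge> 1 \<Longrightarrow> a n > 0"
begin

lemma length_block_pos: "n \<ge> 1 \<Longrightarrow> length (base_repr b (a n)) > 0"
  using length_base_repr_le_iff[OF base, of "a n" 0] pos[of n] by simp

lemma le_length_concat_prefix: "m \<le> length (concat_prefix b a m)"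
proof (induction m)
  case (Suc m)
  then show ?case
    using length_block_pos[of "Suc m"] by (simp add: concat_prefix_Suc del: length_greater_0_conv)
qed simp

text \<open>Both prefixes in question are initial segments of the one with \<open>m + Suc j\<close>
  blocks, so they agree at \<open>j\<close>.\<close>

lemma concat_digit_eq:
  assumes "j < length (concat_prefix b a m)"
  shows "concat_digit b a j = concat_prefix b a m ! j"
proof -
  have "concat_digit b a j = concat_prefix b a (Suc j) ! j"
    by (simp add: concat_digit_def concat_prefix_def)
  moreover have "j < length (concat_prefix b a (Suc j))"
    using le_length_concat_prefix[of "Suc j"] by simp
  moreover have "concat_prefix b a (Suc j) ! j = concat_prefix b a (Suc j + m) ! j"
    using concat_prefix_append[of b a "Suc j" m] calculation(2) by (auto simp: nth_append)
  moreover have "concat_prefix b a m ! j = concat_prefix b a (m + Suc j) ! j"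
    using concat_prefix_append[of b a m "Suc j"] assms by (auto simp: nth_append)
  ultimately show ?thesis
    by (simp add: add.commute)
qed

lemma map_concat_digit:
  assumes "M \<le> length (concat_prefix b a m)"
  shows "map (concat_digit b a) [0..<M] = take M (concat_prefix b a m)"
  using assms by (intro nth_equalityI) (auto simp: concat_digit_eq[of _ m])

lemma concat_digit_less: "concat_digit b a j < b"
proof -
  have j: "j < length (concat_prefix b a (Suc j))"
    using le_length_concat_prefix[of "Suc j"] by simp
  then have "concat_digit b a j \<in> set (concat_prefix b a (Suc j))"
    by (simp add: concat_digit_eq)
  then show ?thesis
    by (auto simp: concat_prefix_def dest: base_repr_less)
qed

text \<open>The growth of the sequence enters only through linear bounds on block lengths:
  \<open>lower\<close> makes the total length quadratic, \<open>upper\<close> caps the damage done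
  by abnormal and truncated blocks.\<close>

lemma real_normal_concat_real:
  assumes c: "c > 0" and lower: "\<And>n. n \<ge> 1 \<Longrightarrow> c * real n \<le> real (length (base_repr b (a n)))"
    and upper: "\<And>n. n \<ge> 1 \<Longrightarrow> real (length (base_repr b (a n))) \<le> C * real n"
    and abnormal: "\<And>\<epsilon> k. \<epsilon> > 0 \<Longrightarrow> k \<ge> 1 \<Longrightarrow>
      (\<lambda>m. real (card {n \<in> {1..m}. \<not> nat_normal \<epsilon> k b (a n)})) \<in> o(\<lambda>m. real m)"
  shows "real_normal b (concat_real b a)"
  unfolding concat_real_def
proof (rule real_normal_digit_series[OF base concat_digit_less])
  fix k w assume k: "k \<ge> 1" and w: "w \<in> base_strings b k"
  define d where "d = concat_digit b a"
  define p where "p = 1 / real b ^ k"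
  define l where "l n = length (base_repr b (a n))" for n
  define L where "L m = length (concat_prefix b a m)" for m
  define B where "B \<epsilon> m = card {n \<in> {1..m}. \<not> nat_normal \<epsilon> k b (a n)}" for \<epsilon> m
  have p: "0 \<le> p" "p \<le> 1"
    using base by (auto simp: p_def)
  have length_w: "length w = k"
    using w by (simp add: base_strings_def)
  then have w_ne: "w \<noteq> []"
    using k by auto
  have C: "C \<ge> 0"
    using upper[of 1] by (metis le_refl mult_1_right of_nat_0_le_iff of_nat_1 order_trans)
  have L_Suc: "L (Suc m) = L m + l (Suc m)" for m
    by (simp add: L_def l_def concat_prefix_Suc)
  \<comment> \<open>Summing \<open>c * n\<close> over the blocks gives
    \<open>c * m * (m + 1) / 2\<close>.\<close>
  have L_lower: "c / 2 * real m ^ 2 \<le> real (L m)" for m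
  proof (induction m)
    case (Suc m)
    have "c * real (Suc m) \<le> real (l (Suc m))"
      using lower[of "Suc m"] by (simp add: l_def)
    then show ?case
      using Suc c by (simp add: L_Suc power2_eq_square field_simps)
  qed simp
  \<comment> \<open>Normality, multiplied by the block length, bounds the discrepancy of a normal
    block; an abnormal block is charged its whole length.\<close>
  have block: "discrepancy p w (base_repr b (a n)) \<le>
      \<epsilon> * real (l n) + (if nat_normal \<epsilon> k b (a n) then 0 else C * real m)"
    if n: "n \<in> {1..m}" and \<epsilon>: "\<epsilon> > 0" for n m \<epsilon>
  proof (cases "nat_normal \<epsilon> k b (a n)")
    case True
    have l_pos: "real (l n) > 0"
      using length_block_pos[of n] n by (simp add: l_def)
    have "\<bar>real (occurrences w (base_repr b (a n))) / real (l n) - p\<bar> \<le> \<epsilon>"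
      using True w by (simp add: nat_normal_def l_def p_def)
    then have "\<bar>real (occurrences w (base_repr b (a n))) / real (l n) - p\<bar> * real (l n)
        \<le> \<epsilon> * real (l n)"
      by (rule mult_right_mono) simp
    also have "\<bar>real (occurrences w (base_repr b (a n))) / real (l n) - p\<bar> * real (l n)
        = \<bar>(real (occurrences w (base_repr b (a n))) / real (l n) - p) * real (l n)\<bar>"
      by (simp add: abs_mult)
    also have "\<dots> = discrepancy p w (base_repr b (a n))"
      using l_pos by (simp add: discrepancy_def l_def left_diff_distrib)
    finally show ?thesis
      using True by simp
  next
    case False
    have "discrepancy p w (base_repr b (a n)) \<le> C * real n"
      using discrepancy_le_length[OF w_ne p] upper[of n] n by (meson atLeastAtMost_iff order_trans)
    also have "\<dots> \<le> C * real m"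
      using n C by (intro mult_left_mono) auto
    finally show ?thesis
      using False \<epsilon> by (simp add: add_increasing)
  qed
  have prefix: "discrepancy p w (concat_prefix b a m) \<le>
      \<epsilon> * real (L m) + C * real m * real (B \<epsilon> m) + real k * real m"
    if \<epsilon>: "\<epsilon> > 0" for m \<epsilon>
  proof -
    have "discrepancy p w (concat_prefix b a m) \<le>
        (\<Sum>n=1..m. discrepancy p w (base_repr b (a n)) + real k)"
      using discrepancy_concat[OF w_ne, of p "map (\<lambda>n. base_repr b (a n)) [1..<Suc m]"]
      by (simp add: concat_prefix_def length_w o_def interv_sum_list_conv_sum_set_nat
          atLeastLessThanSuc_atLeastAtMost del: upt_Suc)
    also have "\<dots> \<le> (\<Sum>n=1..m. \<epsilon> * real (l n) +
        (if nat_normal \<epsilon> k b (a n) then 0 else C * real m) + real k)"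
      using block \<epsilon> by (intro sum_mono add_right_mono) auto
    also have "\<dots> = \<epsilon> * real (L m) + C * real m * real (B \<epsilon> m) + real k * real m"
      by (simp add: sum.distrib sum.If_cases L_def B_def length_concat_prefix l_def
          sum_distrib_left Int_def mult.commute)
    finally show ?thesis .
  qed
  \<comment> \<open>The incomplete block costs at most the full length of block
    \<open>Suc m\<close>, plus \<open>k\<close> for one more junction.\<close>
  have truncation: "discrepancy p w (map d [0..<M]) \<le> \<epsilon> * real (L m) +
      (C * real m * real (B \<epsilon> m) + (real k + C) * (real m + 1))"
    if \<epsilon>: "\<epsilon> > 0" and M: "L m \<le> M" "M \<le> L (Suc m)" for \<epsilon> m M
  proof -
    define v where "v = take (M - L m) (base_repr b (a (Suc m)))"
    have "map d [0..<M] = concat_prefix b a m @ v"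
      using M map_concat_digit[of M "Suc m"]
      by (simp add: L_def d_def v_def concat_prefix_Suc)
    moreover have "discrepancy p w v \<le> C * (real m + 1)"
    proof -
      have "discrepancy p w v \<le> real (l (Suc m))"
        using discrepancy_le_length[OF w_ne p, of v] by (simp add: v_def l_def)
      then show ?thesis
        using upper[of "Suc m"] by (simp add: l_def add.commute)
    qed
    ultimately show ?thesis
      using discrepancy_append[OF w_ne, of p "concat_prefix b a m" v] prefix[OF \<epsilon>, of m]
      by (simp add: length_w algebra_simps)
  qed
  have "(\<lambda>M. real (occurrences w (map d [0..<M])) / real M) \<longlonglongrightarrow> p"
  proof (rule LIMSEQ_I)
    fix e :: real assume e: "e > 0"
    \<comment> \<open>The final estimate is \<open>2 * \<epsilon> * M\<close>, so a third of
      \<open>e\<close> leaves strict room.\<close>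
    define \<epsilon> where "\<epsilon> = e / 3"
    have \<epsilon>: "\<epsilon> > 0"
      using e by (simp add: \<epsilon>_def)
    \<comment> \<open>The constants make each of the two error terms at most
      \<open>\<epsilon> * c / 4 * m ^ 2\<close>; \<open>C + 1\<close> avoids division by zero when
      \<open>C = 0\<close>.\<close>
    have "\<forall>\<^sub>F m in sequentially. norm (real (B \<epsilon> m)) \<le> \<epsilon> * c / (4 * (C + 1)) * norm (real m)"
      unfolding B_def by (rule landau_o.smallD[OF abnormal[OF \<epsilon> k]]) (use c C \<epsilon> in auto)
    moreover have "\<forall>\<^sub>F m in sequentially. nat \<lceil>8 * (real k + C) / (\<epsilon> * c)\<rceil> \<le> m"
      by (rule eventually_ge_at_top)
    ultimately have "\<forall>\<^sub>F m in sequentially.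
        C * real m * real (B \<epsilon> m) + (real k + C) * (real m + 1) \<le> \<epsilon> * (c / 2 * real m ^ 2)"
      using eventually_ge_at_top[of 1]
    proof eventually_elim
      case (elim m)
      have "C * real m * real (B \<epsilon> m) \<le> (C + 1) * real m * (\<epsilon> * c / (4 * (C + 1)) * real m)"
        using elim(1) C by (intro mult_mono) auto
      also have "\<dots> = \<epsilon> * c / 4 * real m ^ 2"
        using C by (simp add: field_simps power2_eq_square)
      finally have 1: "C * real m * real (B \<epsilon> m) \<le> \<epsilon> * c / 4 * real m ^ 2" .
      have "8 * (real k + C) / (\<epsilon> * c) \<le> real m"
        using elim(2) by linarith
      then have 2: "2 * (real k + C) \<le> \<epsilon> * c / 4 * real m"
        using \<epsilon> c by (simp add: field_simps)
      have "(real k + C) * (real m + 1) \<le> (real k + C) * (2 * real m)"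
        using elim(3) C by (intro mult_left_mono) auto
      also have "\<dots> \<le> \<epsilon> * c / 4 * real m * real m"
        using mult_right_mono[OF 2, of "real m"] by (simp add: mult_ac)
      finally show ?case
        using 1 by (simp add: power2_eq_square field_simps)
    qed
    then obtain m\<^sub>0 where m0: "\<And>m. m \<ge> m\<^sub>0 \<Longrightarrow>
        C * real m * real (B \<epsilon> m) + (real k + C) * (real m + 1) \<le> \<epsilon> * (c / 2 * real m ^ 2)"
      by (auto simp: eventually_sequentially)
    show "\<exists>M\<^sub>0. \<forall>M\<ge>M\<^sub>0. norm (real (occurrences w (map d [0..<M])) / real M - p) < e"
    proof (intro exI allI impI)
      \<comment> \<open>The added 1 ensures \<open>M > 0\<close> for the divisions below.\<close>
      fix M assume M: "M \<ge> L m\<^sub>0 + 1"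
      define S where "S = {m. L m \<le> M}"
      have "finite S"
        by (rule finite_subset[of _ "{..M}"])
          (auto simp: S_def L_def intro: order_trans[OF le_length_concat_prefix])
      moreover have "m\<^sub>0 \<in> S"
        using M by (simp add: S_def)
      \<comment> \<open>\<open>Max S\<close> is the number of complete blocks among the first
        \<open>M\<close> digits; \<open>S\<close> is finite because
        \<open>m \<le> L m\<close>.\<close>
      ultimately have Max: "Max S \<in> S" "Max S \<ge> m\<^sub>0" "Suc (Max S) \<notin> S"
        by (auto intro: Max_in dest: Max_ge)
      define m where "m = Max S"
      have m: "L m \<le> M" "M \<le> L (Suc m)" "m \<ge> m\<^sub>0"
        using Max by (auto simp: S_def m_def)
      have "discrepancy p w (map d [0..<M]) \<le> \<epsilon> * real (L m) + \<epsilon> * (c / 2 * real m ^ 2)"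
        using truncation[OF \<epsilon> m(1,2)] m0[OF m(3)] by linarith
      also have "\<dots> \<le> \<epsilon> * real M + \<epsilon> * real M"
        using \<epsilon> m(1) L_lower[of m] by (intro add_mono mult_left_mono) auto
      also have "\<dots> < e * real M"
        using e M by (simp add: \<epsilon>_def)
      finally have "\<bar>real (occurrences w (map d [0..<M])) - p * real M\<bar> < e * real M"
        by (simp add: discrepancy_def)
      moreover have "real (occurrences w (map d [0..<M])) / real M - p =
          (real (occurrences w (map d [0..<M])) - p * real M) / real M"
        using M by (simp add: field_simps)
      ultimately show "norm (real (occurrences w (map d [0..<M])) / real M - p) < e"
        using M by (simp add: pos_divide_less_eq)
    qed
  qed
  then show "(\<lambda>M. real (occurrences w (map (concat_digit b a) [0..<M])) / real M)
      \<longlonglongrightarrow> 1 / real b ^ k"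
    by (simp add: d_def p_def)
qed

end

section \<open>Fibonacci numbers\<close>

lemma fib_less_power: "fib n < 10 ^ n"
  by (induction n rule: fib.induct) auto

text \<open>Six index steps multiply a Fibonacci number by at least 13, hence by more than
  10.\<close>

lemma power_le_fib: "10 ^ k \<le> fib (6 * k + 1)"
proof (induction k)
  case (Suc k)
  have "fib (6 * Suc k + 1) = 13 * fib (6 * k + 1) + 8 * fib (6 * k)"
    by (simp add: numeral_eq_Suc)
  then show ?case
    using Suc by simp
qed simp

lemma length_base_repr_fib_le: "length (base_repr 10 (fib n)) \<le> n"
  by (simp add: length_base_repr_le_iff fib_less_power)

lemma length_base_repr_fib_ge:
  assumes "n \<ge> 1"
  shows "n \<le> 6 * length (base_repr 10 (fib n))"
proof -
  \<comment> \<open>The largest \<open>k\<close> with \<open>6 * k + 1 \<le> n\<close>; having more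
    than \<open>k\<close> digits then suffices, since \<open>n \<le> 6 * (k + 1)\<close>.\<close>
  define k where "k = (n - 1) div 6"
  have "fib (6 * k + 1) \<le> fib n"
    using assms by (intro fib_mono) (simp add: k_def)
  then have "\<not> fib n < 10 ^ k"
    using power_le_fib[of k] by simp
  then have "\<not> length (base_repr 10 (fib n)) \<le> k"
    by (simp add: length_base_repr_le_iff)
  then show ?thesis
    unfolding k_def by linarith
qed

theorem corollary5:
  assumes "\<And>(\<epsilon>::real) (k::nat). \<epsilon> > 0 \<Longrightarrow> k \<ge> 1 \<Longrightarrow>
    (\<lambda>m::nat. real (card {n \<in> {1..m}. \<not> nat_normal \<epsilon> k 10 (fib n)})) \<in> o(\<lambda>m. real m)"
  shows "real_normal 10 (concat_real 10 fib)"
proof -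
  interpret concatenation 10 fib
    by unfold_locales (auto simp: fib_neq_0_nat)
  show ?thesis
  proof (rule real_normal_concat_real[of "1 / 6" 1])
    fix n :: nat assume "n \<ge> 1"
    then show "1 / 6 * real n \<le> real (length (base_repr 10 (fib n)))"
      using length_base_repr_fib_ge[of n] by linarith
    show "real (length (base_repr 10 (fib n))) \<le> 1 * real n"
      using length_base_repr_fib_le[of n] by simp
  qed (use assms in auto)
qed

end
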